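(* Let $$f(\zeta,u)=\exp(k\zeta)+g\,\zeta,$$ where $k$ is a nonzero real constant and $g=g(u)$ is a complex-valued function (class $\mathrm{AE}_{13}$). For the corresponding vacuum pp-wave the following are equivalent: (i) $d\alpha\wedge d\nu=0$; (ii) $Y=0$; (iii) $g=0$.
   Context: Setting. Everything is local, on a small connected coordinate domain with coordinates $(\zeta,\zeta^*,u,v)$, $\zeta$ complex, $u,v$ real; $^*$ (or a bar) is complex conjugation. A (non-flat) vacuum pp-wave is a metric $ds^2=2\,d\zeta\,d\bar\zeta-2\,du\,dv-2(f+\bar f)\,du^2$ with $f=f(\zeta,u)$ complex analytic in $\zeta$, smooth in $u$, $f_{\zeta\zeta}\neq0$ everywhere. Equalities are meant identically on the domain. Normalized tetrad and scalars. Let $a=\tfrac14\log f_{\zeta\zeta}$ and $\alpha=e^{a-a^*}(a_\zeta)^*$ (which is nowhere zero here). Write $\zeta=Z(a,u)$, $L=\log Z_a$ (functions of $(a,u)$), and let $\omega^1=(\alpha^* )^{-1}da=e^{a-a^*}(d\zeta-Z_u\,du)$, $\omega^2=(\omega^1)^*$, $\omega^3=e^{a+a^*}du$, $\omega^4=e^{-a-a^*}\big((f+f^*+Z_uZ_u^* )du+dv-Z_u\,d\zeta^*-Z_u^*\,d\zeta\big)$, so the metric is $2\omega^1\omega^2-2\omega^3\omega^4$. Its dual frame $(\delta,\delta^*,\Delta,D)$ is the null tetrad normalized by $\Psi_4=1$, $\gamma=0$ (Newman–Penrose notation). On functions of $(a,a^*,u)$: $\delta Q=\alpha^*Q_a$,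 $\delta^*Q=\alpha Q_{a^*}$, $\Delta Q=e^{-a-a^*}Q_u$ ($a,a^*$ fixed), $DQ=0$. The remaining spin coefficients are $\mu=e^{-a-a^*}L_u$ (zero here) and $\nu=e^{-a-3a^*}(Z_{uu}+(f_\zeta)^* )$. Invariants: $A=\delta^*\alpha/\alpha^2$ and $Y=(3-A)\nu-1/\alpha+(\Delta\mu+\mu^2)/\alpha^*$. *)

theory Defs
  imports "HOL-Analysis.Analysis"
begin

text \<open>
  Points of the coordinate domain are triples \<open>(\<zeta>, u, v)\<close>, with \<open>\<zeta>\<close> complex and
  \<open>u\<close>, \<open>v\<close> real; the coordinate \<open>\<zeta>\<^sup>*\<close> is \<open>cnj \<zeta>\<close>.  Real tangent vectors have the same type
  \<open>(d\<zeta>, du, dv)\<close>, and complex-valued one-forms are functions of a tangent vector.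
\<close>

type_synonym point = "complex \<times> real \<times> real"
type_synonym form = "point \<Rightarrow> complex"

definition zeta_u_domain :: "point set \<Rightarrow> (complex \<times> real) set" where
  "zeta_u_domain M = (\<lambda>(\<zeta>, u, v). (\<zeta>, u)) ` M"

definition a_u_domain :: "point set \<Rightarrow> (complex \<Rightarrow> real \<Rightarrow> complex) \<Rightarrow> (complex \<times> real) set" where
  "a_u_domain M a = (\<lambda>(\<zeta>, u, v). (a \<zeta> u, u)) ` M"

text \<open>
  Partial derivatives of a function of one complex variable (in which it is holomorphic)
  and the real variable \<open>u\<close>.
\<close>

definition d_z :: "(complex \<Rightarrow> real \<Rightarrow> complex) \<Rightarrow> complex \<Rightarrow> real \<Rightarrow> complex" where
  "d_z F z u = deriv (\<lambda>w. F w u) z"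

definition d_u :: "(complex \<Rightarrow> real \<Rightarrow> complex) \<Rightarrow> complex \<Rightarrow> real \<Rightarrow> complex" where
  "d_u F z u = vector_derivative (\<lambda>t. F z t) (at u)"

text \<open>\<open>C\<^sup>k\<close> and \<open>C\<^sup>\<infinity>\<close> (in the real sense) on an open subset of a Euclidean space.\<close>

fun k_smooth_on ::
  "nat \<Rightarrow> 'a::euclidean_space set \<Rightarrow> ('a \<Rightarrow> 'b::real_normed_vector) \<Rightarrow> bool" where
  "k_smooth_on 0 S F \<longleftrightarrow> continuous_on S F"
| "k_smooth_on (Suc n) S F \<longleftrightarrow>
     (\<forall>x\<in>S. F differentiable (at x)) \<and>
     (\<forall>h. k_smooth_on n S (\<lambda>x. frechet_derivative F (at x) h))"

definition smooth_on :: "'a::euclidean_space set \<Rightarrow> ('a \<Rightarrow> 'b::real_normed_vector) \<Rightarrow> bool" where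
  "smooth_on S F \<longleftrightarrow> (\<forall>n. k_smooth_on n S F)"

definition pp_metric :: "(complex \<Rightarrow> real \<Rightarrow> complex) \<Rightarrow> point \<Rightarrow> point \<Rightarrow> complex" where
  "pp_metric f = (\<lambda>(\<zeta>, u, v) (d\<zeta>, du, dv).
     2 * d\<zeta> * cnj d\<zeta> - 2 * of_real du * of_real dv
       - 2 * (f \<zeta> u + cnj (f \<zeta> u)) * (of_real du)\<^sup>2)"

text \<open>
  The metric \<open>pp_metric f\<close> on \<open>M\<close> is a non-flat vacuum pp-wave.
\<close>

definition vacuum_pp_wave :: "point set \<Rightarrow> (complex \<Rightarrow> real \<Rightarrow> complex) \<Rightarrow> bool" where
  "vacuum_pp_wave M f \<longleftrightarrow>
     open M \<and> connected M \<and> M \<noteq> {} \<and>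
     smooth_on (zeta_u_domain M) (\<lambda>(\<zeta>, u). f \<zeta> u) \<and>
     (\<forall>u. (\<lambda>\<zeta>. f \<zeta> u) holomorphic_on {\<zeta>. (\<zeta>, u) \<in> zeta_u_domain M}) \<and>
     (\<forall>(\<zeta>, u) \<in> zeta_u_domain M. d_z (d_z f) \<zeta> u \<noteq> 0)"

definition alpha :: "(complex \<Rightarrow> real \<Rightarrow> complex) \<Rightarrow> point \<Rightarrow> complex" where
  "alpha a = (\<lambda>(\<zeta>, u, v). exp (a \<zeta> u - cnj (a \<zeta> u)) * cnj (d_z a \<zeta> u))"

text \<open>
  The local choices behind the normalized tetrad: a branch \<open>a\<close> of
  \<open>\<onequarter> log f\<^bsub>\<zeta>\<zeta>\<^esub>\<close>, the inverse function \<open>\<zeta> = Z(a, u)\<close> of \<open>\<zeta> \<mapsto> a(\<zeta>, u)\<close>,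
  and a branch \<open>L\<close> of \<open>log Z\<^sub>a\<close>.  The domain \<open>M\<close> has to be small enough for them to exist.
\<close>

definition adapted_functions ::
  "point set \<Rightarrow> (complex \<Rightarrow> real \<Rightarrow> complex) \<Rightarrow> (complex \<Rightarrow> real \<Rightarrow> complex) \<Rightarrow>
   (complex \<Rightarrow> real \<Rightarrow> complex) \<Rightarrow> (complex \<Rightarrow> real \<Rightarrow> complex) \<Rightarrow> bool" where
  "adapted_functions M f a Z L \<longleftrightarrow>
     continuous_on (zeta_u_domain M) (\<lambda>(\<zeta>, u). a \<zeta> u) \<and>
     (\<forall>(\<zeta>, u) \<in> zeta_u_domain M. exp (4 * a \<zeta> u) = d_z (d_z f) \<zeta> u) \<and>
     (\<forall>p \<in> M. alpha a p \<noteq> 0) \<and>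
     (\<forall>(\<zeta>, u) \<in> zeta_u_domain M. Z (a \<zeta> u) u = \<zeta>) \<and>
     continuous_on (a_u_domain M a) (\<lambda>(b, u). L b u) \<and>
     (\<forall>(b, u) \<in> a_u_domain M a. exp (L b u) = d_z Z b u)"

text \<open>The null coframe; \<open>d\<zeta>\<^sup>*\<close> takes the value \<open>cnj d\<zeta>\<close> on a real tangent vector.\<close>

definition omega1 ::
  "(complex \<Rightarrow> real \<Rightarrow> complex) \<Rightarrow> (complex \<Rightarrow> real \<Rightarrow> complex) \<Rightarrow> point \<Rightarrow> form" where
  "omega1 a Z = (\<lambda>(\<zeta>, u, v) (d\<zeta>, du, dv).
     exp (a \<zeta> u - cnj (a \<zeta> u)) * (d\<zeta> - d_u Z (a \<zeta> u) u * of_real du))"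

definition omega2 ::
  "(complex \<Rightarrow> real \<Rightarrow> complex) \<Rightarrow> (complex \<Rightarrow> real \<Rightarrow> complex) \<Rightarrow> point \<Rightarrow> form" where
  "omega2 a Z p h = cnj (omega1 a Z p h)"

definition omega3 :: "(complex \<Rightarrow> real \<Rightarrow> complex) \<Rightarrow> point \<Rightarrow> form" where
  "omega3 a = (\<lambda>(\<zeta>, u, v) (d\<zeta>, du, dv). exp (a \<zeta> u + cnj (a \<zeta> u)) * of_real du)"

definition omega4 ::
  "(complex \<Rightarrow> real \<Rightarrow> complex) \<Rightarrow> (complex \<Rightarrow> real \<Rightarrow> complex) \<Rightarrow>
   (complex \<Rightarrow> real \<Rightarrow> complex) \<Rightarrow> point \<Rightarrow> form" where
  "omega4 f a Z = (\<lambda>(\<zeta>, u, v) (d\<zeta>, du, dv).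
     exp (- a \<zeta> u - cnj (a \<zeta> u)) *
       ((f \<zeta> u + cnj (f \<zeta> u) + d_u Z (a \<zeta> u) u * cnj (d_u Z (a \<zeta> u) u)) * of_real du
        + of_real dv - d_u Z (a \<zeta> u) u * cnj d\<zeta> - cnj (d_u Z (a \<zeta> u) u) * d\<zeta>))"

lemma pp_metric_eq_coframe:
  "pp_metric f p h =
     2 * omega1 a Z p h * omega2 a Z p h - 2 * omega3 a p h * omega4 f a Z p h"
proof -
  obtain \<zeta> u v where p: "p = (\<zeta>, u, v)" by (cases p) auto
  obtain d\<zeta> du dv where h: "h = (d\<zeta>, du, dv)" by (cases h) auto
  define b where "b = a \<zeta> u"
  have e1: "exp (b - cnj b) * exp (cnj b - b) = 1"
    by (simp flip: exp_add)
  have e2: "exp (b + cnj b) * exp (- b - cnj b) = 1"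
    by (simp flip: exp_add)
  define w where "w = d_u Z b u"
  have "2 * omega1 a Z p h * omega2 a Z p h =
          2 * (exp (b - cnj b) * exp (cnj b - b)) *
            ((d\<zeta> - w * of_real du) * (cnj d\<zeta> - cnj w * of_real du))"
    by (simp add: p h omega1_def omega2_def b_def w_def exp_cnj mult_ac)
  moreover have "2 * omega3 a p h * omega4 f a Z p h =
          2 * (exp (b + cnj b) * exp (- b - cnj b)) * of_real du *
            ((f \<zeta> u + cnj (f \<zeta> u) + w * cnj w) * of_real du
              + of_real dv - w * cnj d\<zeta> - cnj w * d\<zeta>)"
    by (simp add: p h omega3_def omega4_def b_def w_def mult_ac)
  moreover have "pp_metric f p h =
          2 * ((d\<zeta> - w * of_real du) * (cnj d\<zeta> - cnj w * of_real du))
          - 2 * of_real du * ((f \<zeta> u + cnj (f \<zeta> u) + w * cnj w) * of_real du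
              + of_real dv - w * cnj d\<zeta> - cnj w * d\<zeta>)"
    by (simp add: p h pp_metric_def power2_eq_square algebra_simps)
  ultimately show ?thesis
    unfolding e1 e2 by (simp add: mult.assoc)
qed

text \<open>
  The dual frame \<open>(\<delta>, \<delta>\<^sup>*, \<Delta>, D)\<close> acts on a function \<open>Q\<close> by
  \<open>dQ = (\<delta>Q) \<omega>\<^sup>1 + (\<delta>\<^sup>*Q) \<omega>\<^sup>2 + (\<Delta>Q) \<omega>\<^sup>3 + (DQ) \<omega>\<^sup>4\<close>.
\<close>

definition ext_d :: "(point \<Rightarrow> complex) \<Rightarrow> point \<Rightarrow> form" where
  "ext_d Q p = frechet_derivative Q (at p)"

definition wedge :: "form \<Rightarrow> form \<Rightarrow> point \<Rightarrow> point \<Rightarrow> complex" where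
  "wedge \<phi> \<psi> h k = \<phi> h * \<psi> k - \<phi> k * \<psi> h"

definition frame_derivs ::
  "(complex \<Rightarrow> real \<Rightarrow> complex) \<Rightarrow> (complex \<Rightarrow> real \<Rightarrow> complex) \<Rightarrow>
   (complex \<Rightarrow> real \<Rightarrow> complex) \<Rightarrow> (point \<Rightarrow> complex) \<Rightarrow> point \<Rightarrow>
   complex \<times> complex \<times> complex \<times> complex" where
  "frame_derivs f a Z Q p = (THE (q1, q2, q3, q4).
     \<forall>h. ext_d Q p h =
       q1 * omega1 a Z p h + q2 * omega2 a Z p h + q3 * omega3 a p h + q4 * omega4 f a Z p h)"

lemma frame_derivs_eqI:
  assumes "\<And>h. ext_d Q p h =
     q1 * omega1 a Z p h + q2 * omega2 a Z p h + q3 * omega3 a p h + q4 * omega4 f a Z p h"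
  shows "frame_derivs f a Z Q p = (q1, q2, q3, q4)"
proof -
  obtain \<zeta> u v where p: "p = (\<zeta>, u, v)" by (cases p) auto
  have "r1 = q1 \<and> r2 = q2 \<and> r3 = q3 \<and> r4 = q4"
    if r: "\<forall>h. ext_d Q p h =
      r1 * omega1 a Z p h + r2 * omega2 a Z p h + r3 * omega3 a p h + r4 * omega4 f a Z p h"
    for r1 r2 r3 r4
  proof -
    have eq: "r1 * omega1 a Z p h + r2 * omega2 a Z p h + r3 * omega3 a p h + r4 * omega4 f a Z p h
        = q1 * omega1 a Z p h + q2 * omega2 a Z p h + q3 * omega3 a p h + q4 * omega4 f a Z p h"
      for h
      using r assms by metis
    have r4: "r4 = q4"
      using eq[of "(0, 0, 1)"] by (simp add: p omega1_def omega2_def omega3_def omega4_def)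
    define e where "e = exp (a \<zeta> u - cnj (a \<zeta> u))"
    have "e \<noteq> 0" by (simp add: e_def)
    have "r1 * e + r2 * cnj e = q1 * e + q2 * cnj e"
      using eq[of "(1, 0, 0)"] r4
      by (simp add: p omega1_def omega2_def omega3_def omega4_def e_def)
    moreover have "\<i> * (r1 * e - r2 * cnj e) = \<i> * (q1 * e - q2 * cnj e)"
      using eq[of "(\<i>, 0, 0)"] r4
      by (simp add: p omega1_def omega2_def omega3_def omega4_def e_def algebra_simps)
    then have "r1 * e - r2 * cnj e = q1 * e - q2 * cnj e" by simp
    ultimately have "2 * (r1 * e) = 2 * (q1 * e)" "2 * (r2 * cnj e) = 2 * (q2 * cnj e)"
      by algebra+
    with \<open>e \<noteq> 0\<close> have "r1 = q1" "r2 = q2" by simp_all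
    with r4 show ?thesis
      using eq[of "(0, 1, 0)"] by (simp add: p omega3_def)
  qed
  then have "(THE (r1, r2, r3, r4). \<forall>h. ext_d Q p h =
      r1 * omega1 a Z p h + r2 * omega2 a Z p h + r3 * omega3 a p h + r4 * omega4 f a Z p h)
      = (q1, q2, q3, q4)"
    using assms by (intro the_equality) (auto split: prod.splits)
  then show ?thesis by (simp add: frame_derivs_def)
qed

definition delta_star ::
  "(complex \<Rightarrow> real \<Rightarrow> complex) \<Rightarrow> (complex \<Rightarrow> real \<Rightarrow> complex) \<Rightarrow>
   (complex \<Rightarrow> real \<Rightarrow> complex) \<Rightarrow> (point \<Rightarrow> complex) \<Rightarrow> point \<Rightarrow> complex" where
  "delta_star f a Z Q p = (case frame_derivs f a Z Q p of (q1, q2, q3, q4) \<Rightarrow> q2)"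

definition Delta ::
  "(complex \<Rightarrow> real \<Rightarrow> complex) \<Rightarrow> (complex \<Rightarrow> real \<Rightarrow> complex) \<Rightarrow>
   (complex \<Rightarrow> real \<Rightarrow> complex) \<Rightarrow> (point \<Rightarrow> complex) \<Rightarrow> point \<Rightarrow> complex" where
  "Delta f a Z Q p = (case frame_derivs f a Z Q p of (q1, q2, q3, q4) \<Rightarrow> q3)"

text \<open>
  \<open>Z\<close> and \<open>L\<close> are differentiated as functions of \<open>(a, u)\<close>, and then evaluated at \<open>a = a(\<zeta>, u)\<close>.
\<close>

definition mu ::
  "(complex \<Rightarrow> real \<Rightarrow> complex) \<Rightarrow> (complex \<Rightarrow> real \<Rightarrow> complex) \<Rightarrow> point \<Rightarrow> complex" where
  "mu a L = (\<lambda>(\<zeta>, u, v). exp (- a \<zeta> u - cnj (a \<zeta> u)) * d_u L (a \<zeta> u) u)"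

definition nu ::
  "(complex \<Rightarrow> real \<Rightarrow> complex) \<Rightarrow> (complex \<Rightarrow> real \<Rightarrow> complex) \<Rightarrow>
   (complex \<Rightarrow> real \<Rightarrow> complex) \<Rightarrow> point \<Rightarrow> complex" where
  "nu f a Z = (\<lambda>(\<zeta>, u, v).
     exp (- a \<zeta> u - 3 * cnj (a \<zeta> u)) * (d_u (d_u Z) (a \<zeta> u) u + cnj (d_z f \<zeta> u)))"

definition inv_A ::
  "(complex \<Rightarrow> real \<Rightarrow> complex) \<Rightarrow> (complex \<Rightarrow> real \<Rightarrow> complex) \<Rightarrow>
   (complex \<Rightarrow> real \<Rightarrow> complex) \<Rightarrow> point \<Rightarrow> complex" where
  "inv_A f a Z p = delta_star f a Z (alpha a) p / (alpha a p)\<^sup>2"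

definition inv_Y ::
  "(complex \<Rightarrow> real \<Rightarrow> complex) \<Rightarrow> (complex \<Rightarrow> real \<Rightarrow> complex) \<Rightarrow>
   (complex \<Rightarrow> real \<Rightarrow> complex) \<Rightarrow> (complex \<Rightarrow> real \<Rightarrow> complex) \<Rightarrow> point \<Rightarrow> complex" where
  "inv_Y f a Z L p =
     (3 - inv_A f a Z p) * nu f a Z p - 1 / alpha a p
     + (Delta f a Z (mu a L) p + (mu a L p)\<^sup>2) / cnj (alpha a p)"

end

theory Submission
  imports Defs
begin

text \<open>
  Since \<open>f\<^bsub>\<zeta>\<zeta>\<^esub> = k\<^sup>2 exp (k\<zeta>)\<close>, continuity on the connected domain forces \<open>a = k\<zeta>/4 + c\<close> with a
  constant \<open>c\<close>.  Hence \<open>Z\<close> does not depend on \<open>u\<close> and \<open>L\<close> is constant, so that \<open>\<mu> = 0\<close>,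
  \<open>\<alpha> = (k/4) exp (a - a\<^sup>*)\<close>, \<open>A = -1\<close> and \<open>\<nu> = 1/(4\<alpha>) + g\<^sup>* exp (-a - 3a\<^sup>*)\<close>.  Therefore
  \<open>Y = 4 g\<^sup>* exp (-a - 3a\<^sup>*)\<close>, which vanishes exactly when \<open>g\<close> does.  In that case \<open>\<nu>\<close> is a
  function of \<open>\<alpha>\<close>.  Conversely, a real translation of \<open>\<zeta>\<close> leaves \<open>\<alpha>\<close> and the first term of
  \<open>\<nu>\<close> unchanged and rescales the second one, so \<open>d\<alpha> \<and> d\<nu> = 0\<close> forces \<open>g = 0\<close>.
\<close>

section \<open>Branches of logarithms, local differentiation, projection of the domain\<close>

lemma continuous_on_exp_constant:
  fixes h :: "'a::topological_space \<Rightarrow> complex"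
  assumes "connected S" "continuous_on S h" "\<And>x. x \<in> S \<Longrightarrow> exp (h x) = K"
  shows "h constant_on S"
proof (rule continuous_discrete_range_constant[OF assms(1,2)])
  fix x assume "x \<in> S"
  \<comment> \<open>Two logarithms of \<open>K\<close> differ by an integer multiple of
    \<open>2 * pi * \<i>\<close>, so distinct values of \<open>h\<close> stay at least
    \<open>2 * pi\<close> apart.\<close>
  have "2 * pi \<le> norm (h y - h x)" if "y \<in> S" "h y \<noteq> h x" for y
  proof -
    from assms(3) that(1) \<open>x \<in> S\<close> have "exp (h y) = exp (h x)" by simp
    then obtain n :: int where n: "h y = h x + of_int (2 * n) * pi * \<i>"
      by (auto simp: exp_eq)
    with that(2) have "n \<noteq> 0" by auto
    then have "1 \<le> \<bar>real_of_int n\<bar>" by linarith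
    with n show ?thesis by (simp add: norm_mult)
  qed
  then show "\<exists>e>0. \<forall>y. y \<in> S \<and> h y \<noteq> h x \<longrightarrow> e \<le> norm (h y - h x)"
    using pi_gt_zero by (intro exI[of _ "2 * pi"]) auto
qed

text \<open>Chain rule for a holomorphic function after a merely real-differentiable one, as in
  exponentials that involve both \<open>\<zeta>\<close> and \<open>cnj \<zeta>\<close>.\<close>

lemma has_derivative_compose_field_derivative:
  assumes "(F has_field_derivative D) (at (h x))" "(h has_derivative h') (at x)"
  shows "((\<lambda>x. F (h x)) has_derivative (\<lambda>y. D * h' y)) (at x)"
  using has_derivative_compose[OF assms(2)] assms(1) by (simp add: has_field_derivative_def)

lemma ext_d_eqI:
  assumes "open M" "p \<in> M" "\<And>q. q \<in> M \<Longrightarrow> Q q = R q" "(R has_derivative D) (at p)"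
  shows "ext_d Q p = D"
proof -
  have "(Q has_derivative D) (at p)"
    using has_derivative_transform_within_open[OF assms(4,1,2)] assms(3) by simp
  then show ?thesis
    unfolding ext_d_def by (rule frechet_derivative_at[symmetric])
qed

text \<open>The derivative sees only the slice of \<open>T\<close> at fixed \<open>u\<close>, which
  is open because \<open>T\<close> is. Closed forms known only on the domain can thus be
  differentiated there.\<close>

lemma d_z_eqI:
  assumes "open T" "(z, u) \<in> T" "\<And>w t. (w, t) \<in> T \<Longrightarrow> F w t = G w t"
    and "((\<lambda>w. G w u) has_field_derivative D) (at z)"
  shows "d_z F z u = D"
proof -
  have "open {w. (w, u) \<in> T}"
    using open_vimage[OF assms(1), of "\<lambda>w. (w, u)"] by (simp add: vimage_def continuous_intros)
  with assms(4) have "((\<lambda>w. F w u) has_field_derivative D) (at z)"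
    by (rule has_field_derivative_transform_within_open) (use assms(2,3) in auto)
  then show ?thesis unfolding d_z_def by (rule DERIV_imp_deriv)
qed

lemma d_u_eqI:
  assumes "open T" "(z, u) \<in> T" "\<And>w t. (w, t) \<in> T \<Longrightarrow> F w t = G w t"
    and "((\<lambda>t. G z t) has_vector_derivative D) (at u)"
  shows "d_u F z u = D"
proof -
  have "open {t. (z, t) \<in> T}"
    using open_vimage[OF assms(1), of "\<lambda>t. (z, t)"] by (simp add: vimage_def continuous_intros)
  with assms(4) have "((\<lambda>t. F z t) has_vector_derivative D) (at u)"
    by (rule has_vector_derivative_transform_within_open) (use assms(2,3) in auto)
  then show ?thesis unfolding d_u_def by (rule vector_derivative_at)
qed

text \<open>Forgetting \<open>v\<close> is an open map: a box around a point of \<open>M\<close>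
  projects onto a box.\<close>

lemma open_zeta_u_domain:
  assumes "open M"
  shows "open (zeta_u_domain M)"
proof (subst open_prod_def, clarify)
  fix \<zeta> u assume "(\<zeta>, u) \<in> zeta_u_domain M"
  then obtain v where "(\<zeta>, u, v) \<in> M" by (auto simp: zeta_u_domain_def)
  with assms obtain A B where AB: "open A" "open B" "(\<zeta>, u, v) \<in> A \<times> B" "A \<times> B \<subseteq> M"
    by (rule open_prod_elim)
  then obtain C D where CD: "open C" "open D" "(u, v) \<in> C \<times> D" "C \<times> D \<subseteq> B"
    by (metis open_prod_elim mem_Sigma_iff)
  have "A \<times> C \<subseteq> zeta_u_domain M"
  proof clarify
    fix w t assume "w \<in> A" "t \<in> C"
    with AB CD have "(w, t, v) \<in> M" by blast
    then show "(w, t) \<in> zeta_u_domain M" by (force simp: zeta_u_domain_def)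
  qed
  with AB CD show "\<exists>A B. open A \<and> open B \<and> (\<zeta>, u) \<in> A \<times> B \<and> A \<times> B \<subseteq> zeta_u_domain M"
    by (intro exI[of _ A] exI[of _ C]) auto
qed

lemma connected_zeta_u_domain:
  assumes "connected M"
  shows "connected (zeta_u_domain M)"
  unfolding zeta_u_domain_def case_prod_unfold
  by (intro connected_continuous_image assms continuous_intros)

section \<open>The functions \<open>a\<close>, \<open>Z\<close>, \<open>L\<close> and the vanishing
  of \<open>mu\<close>\<close>

locale AE13 =
  fixes M :: "point set" and k :: real and g :: "real \<Rightarrow> complex"
    and f a Z L :: "complex \<Rightarrow> real \<Rightarrow> complex"
  assumes k: "k \<noteq> 0"
    and f: "f = (\<lambda>\<zeta> u. exp (of_real k * \<zeta>) + g u * \<zeta>)"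
    and wave: "vacuum_pp_wave M f"
    and adapted: "adapted_functions M f a Z L"
begin

abbreviation W :: "(complex \<times> real) set" where "W \<equiv> zeta_u_domain M"

lemma open_M: "open M" and open_W: "open W" and connected_W: "connected W"
  using wave open_zeta_u_domain connected_zeta_u_domain by (auto simp: vacuum_pp_wave_def)

lemma W_I: "(\<zeta>, u, v) \<in> M \<Longrightarrow> (\<zeta>, u) \<in> W"
  by (force simp: zeta_u_domain_def)

lemma d_z_f: "d_z f \<zeta> u = of_real k * exp (of_real k * \<zeta>) + g u"
  unfolding d_z_def f by (rule DERIV_imp_deriv) (auto intro!: derivative_eq_intros)

lemma d_z_d_z_f: "d_z (d_z f) \<zeta> u = (of_real k)\<^sup>2 * exp (of_real k * \<zeta>)"
proof -
  have "((\<lambda>w. d_z f w u) has_field_derivative (of_real k)\<^sup>2 * exp (of_real k * \<zeta>)) (at \<zeta>)"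
    unfolding d_z_f by (auto intro!: derivative_eq_intros simp: power2_eq_square)
  then show ?thesis unfolding d_z_def[of "d_z f"] by (rule DERIV_imp_deriv)
qed

text \<open>The function \<open>4 * a \<zeta> u - of_real k * \<zeta>\<close> is a continuous
  logarithm of the constant \<open>k\<^sup>2\<close>. Connectedness of \<open>W\<close> as a whole,
  not of its slices, makes it constant in \<open>u\<close> as well as in
  \<open>\<zeta>\<close>.\<close>

lemma a_affine:
  obtains c where "exp (4 * c) = (of_real k)\<^sup>2"
    and "\<And>\<zeta> u. (\<zeta>, u) \<in> W \<Longrightarrow> a \<zeta> u = of_real k * \<zeta> / 4 + c"
proof -
  have K: "exp (4 * a \<zeta> u - of_real k * \<zeta>) = (of_real k)\<^sup>2" if "(\<zeta>, u) \<in> W" for \<zeta> u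
    using adapted that by (auto simp: adapted_functions_def d_z_d_z_f exp_diff)
  have "continuous_on W (\<lambda>(\<zeta>, u). a \<zeta> u)"
    using adapted by (simp add: adapted_functions_def)
  then have "continuous_on W (\<lambda>p. 4 * a (fst p) (snd p) - of_real k * fst p)"
    unfolding case_prod_unfold by (intro continuous_intros)
  then have "(\<lambda>p. 4 * a (fst p) (snd p) - of_real k * fst p) constant_on W"
    by (rule continuous_on_exp_constant[OF connected_W]) (use K in auto)
  then obtain d where "\<forall>p\<in>W. 4 * a (fst p) (snd p) - of_real k * fst p = d"
    by (auto simp: constant_on_def)
  then have d: "4 * a \<zeta> u - of_real k * \<zeta> = d" if "(\<zeta>, u) \<in> W" for \<zeta> u
    using that by force
  have "W \<noteq> {}"
    using wave by (simp add: vacuum_pp_wave_def zeta_u_domain_def)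
  then obtain q where "q \<in> W" by blast
  show ?thesis
  proof (rule that[of "d / 4"])
    show "exp (4 * (d / 4)) = (of_real k)\<^sup>2"
      using K[of "fst q" "snd q"] d[of "fst q" "snd q"] \<open>q \<in> W\<close> by simp
    show "a \<zeta> u = of_real k * \<zeta> / 4 + d / 4" if "(\<zeta>, u) \<in> W" for \<zeta> u
      using d[OF that] by (auto simp: field_simps)
  qed
qed

text \<open>Fixes the constant of \<open>a_affine\<close> once, so that all later closed forms can
  share it.\<close>

definition c :: complex where
  "c = (SOME c. exp (4 * c) = (of_real k)\<^sup>2 \<and>
          (\<forall>\<zeta> u. (\<zeta>, u) \<in> W \<longrightarrow> a \<zeta> u = of_real k * \<zeta> / 4 + c))"

lemma exp_c: "exp (4 * c) = (of_real k)\<^sup>2"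
  and a_eq: "(\<zeta>, u) \<in> W \<Longrightarrow> a \<zeta> u = of_real k * \<zeta> / 4 + c"
proof -
  have "\<exists>c. exp (4 * c) = (of_real k)\<^sup>2 \<and>
          (\<forall>\<zeta> u. (\<zeta>, u) \<in> W \<longrightarrow> a \<zeta> u = of_real k * \<zeta> / 4 + c)"
    using a_affine by metis
  then have "exp (4 * c) = (of_real k)\<^sup>2 \<and>
          (\<forall>\<zeta> u. (\<zeta>, u) \<in> W \<longrightarrow> a \<zeta> u = of_real k * \<zeta> / 4 + c)"
    unfolding c_def by (rule someI_ex)
  then show "exp (4 * c) = (of_real k)\<^sup>2"
    and "(\<zeta>, u) \<in> W \<Longrightarrow> a \<zeta> u = of_real k * \<zeta> / 4 + c" by auto
qed

lemma a_u_domain_image: "a_u_domain M a = (\<lambda>(\<zeta>, u). (of_real k * \<zeta> / 4 + c, u)) ` W"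
proof -
  have "a_u_domain M a = (\<lambda>(\<zeta>, u). (a \<zeta> u, u)) ` W"
    by (simp add: a_u_domain_def zeta_u_domain_def image_image case_prod_unfold)
  also have "\<dots> = (\<lambda>(\<zeta>, u). (of_real k * \<zeta> / 4 + c, u)) ` W"
    by (intro image_cong refl) (auto simp: a_eq)
  finally show ?thesis .
qed

text \<open>The affine map is inverted, so the domain in \<open>(a, u)\<close> becomes a preimage of
  \<open>W\<close>; its openness follows from this form, its connectedness from the image
  form.\<close>

lemma a_u_domain_iff: "(b, u) \<in> a_u_domain M a \<longleftrightarrow> (4 * (b - c) / of_real k, u) \<in> W"
proof
  show "(b, u) \<in> a_u_domain M a" if "(4 * (b - c) / of_real k, u) \<in> W"
    unfolding a_u_domain_image using k by (intro rev_image_eqI[OF that]) (simp add: field_simps)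
  show "(4 * (b - c) / of_real k, u) \<in> W" if "(b, u) \<in> a_u_domain M a"
    using that k by (auto simp: a_u_domain_image)
qed

lemma open_a_u_domain: "open (a_u_domain M a)"
proof -
  have "a_u_domain M a = (\<lambda>(b, u). (4 * (b - c) / of_real k, u)) -` W"
    using a_u_domain_iff by auto
  moreover have "open ((\<lambda>(b, u). (4 * (b - c) / of_real k, u)) -` W)"
    unfolding case_prod_unfold using k
    by (intro open_vimage open_W continuous_intros) auto
  ultimately show ?thesis by simp
qed

lemma connected_a_u_domain: "connected (a_u_domain M a)"
  unfolding a_u_domain_image case_prod_unfold
  by (intro connected_continuous_image connected_W continuous_intros) auto

text \<open>The left-inverse condition on \<open>Z\<close>, taken at the point of \<open>W\<close>
  that \<open>a\<close> sends to \<open>b\<close>, determines \<open>Z\<close> on the whole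
  \<open>(a, u)\<close> domain.\<close>

lemma Z_eq:
  assumes "(b, u) \<in> a_u_domain M a"
  shows "Z b u = 4 * (b - c) / of_real k"
proof -
  have W: "(4 * (b - c) / of_real k, u) \<in> W" using assms a_u_domain_iff by simp
  then have "Z (a (4 * (b - c) / of_real k) u) u = 4 * (b - c) / of_real k"
    using adapted by (auto simp: adapted_functions_def)
  moreover have "a (4 * (b - c) / of_real k) u = b"
    using a_eq[OF W] k by (simp add: field_simps)
  ultimately show ?thesis by simp
qed

lemma d_u_Z: "(b, u) \<in> a_u_domain M a \<Longrightarrow> d_u Z b u = 0"
  by (rule d_u_eqI[OF open_a_u_domain, of _ _ _ "\<lambda>b u. 4 * (b - c) / of_real k"])
     (auto simp: Z_eq)

lemma d_u_d_u_Z: "(b, u) \<in> a_u_domain M a \<Longrightarrow> d_u (d_u Z) b u = 0"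
  by (rule d_u_eqI[OF open_a_u_domain, of _ _ _ "\<lambda>b u. 0"]) (auto simp: d_u_Z)

lemma d_z_Z: "(b, u) \<in> a_u_domain M a \<Longrightarrow> d_z Z b u = 4 / of_real k"
  by (rule d_z_eqI[OF open_a_u_domain, of _ _ _ "\<lambda>b u. 4 * (b - c) / of_real k"])
     (use k in \<open>auto simp: Z_eq intro!: derivative_eq_intros\<close>)

text \<open>Here \<open>L\<close> is a continuous logarithm of the constant
  \<open>4 / of_real k\<close> on a connected set, so the argument used for \<open>a\<close> applies
  again.\<close>

lemma d_u_L:
  assumes "(b, u) \<in> a_u_domain M a"
  shows "d_u L b u = 0"
proof -
  have "(\<lambda>(b, u). L b u) constant_on a_u_domain M a"
  proof (rule continuous_on_exp_constant[OF connected_a_u_domain])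
    show "continuous_on (a_u_domain M a) (\<lambda>(b, u). L b u)"
      using adapted by (simp add: adapted_functions_def)
    show "exp ((\<lambda>(b, u). L b u) x) = 4 / of_real k" if "x \<in> a_u_domain M a" for x
      using adapted that by (auto simp: adapted_functions_def d_z_Z)
  qed
  then obtain l where "\<forall>x\<in>a_u_domain M a. (\<lambda>(b, u). L b u) x = l"
    unfolding constant_on_def ..
  then show ?thesis
    by (intro d_u_eqI[OF open_a_u_domain assms, of _ "\<lambda>b u. l"]) auto
qed

lemma a_mem: "(\<zeta>, u, v) \<in> M \<Longrightarrow> (a \<zeta> u, u) \<in> a_u_domain M a"
  by (force simp: a_u_domain_def)

lemma mu_eq: "p \<in> M \<Longrightarrow> mu a L p = 0"
  by (cases p) (auto simp: mu_def d_u_L a_mem)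

lemma Delta_mu:
  assumes "p \<in> M"
  shows "Delta f a Z (mu a L) p = 0"
proof -
  have "ext_d (mu a L) p = (\<lambda>_. 0)"
    by (rule ext_d_eqI[OF open_M assms, of _ "\<lambda>_. 0"]) (auto simp: mu_eq)
  then have "frame_derivs f a Z (mu a L) p = (0, 0, 0, 0)"
    by (intro frame_derivs_eqI) simp
  then show ?thesis by (simp add: Delta_def)
qed

section \<open>Closed forms of \<open>alpha\<close> and \<open>nu\<close>, and their
  derivatives\<close>

text \<open>On the domain, \<open>E\<close> is \<open>exp (a - cnj a)\<close> and \<open>G\<close>
  below is \<open>exp (- a - 3 * cnj a)\<close>. Written in \<open>\<zeta>\<close> alone they are
  differentiable everywhere.\<close>

definition E :: "complex \<Rightarrow> complex" where
  "E \<zeta> = exp (of_real k * (\<zeta> - cnj \<zeta>) / 4 + (c - cnj c))"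

definition G :: "complex \<Rightarrow> complex" where
  "G \<zeta> = exp (- of_real k * (\<zeta> + 3 * cnj \<zeta>) / 4 - (c + 3 * cnj c))"

lemma d_z_a: "(\<zeta>, u) \<in> W \<Longrightarrow> d_z a \<zeta> u = of_real k / 4"
  by (rule d_z_eqI[OF open_W, of _ _ _ "\<lambda>\<zeta> u. of_real k * \<zeta> / 4 + c"])
     (auto simp: a_eq intro!: derivative_eq_intros)

lemma alpha_eq: "(\<zeta>, u, v) \<in> M \<Longrightarrow> alpha a (\<zeta>, u, v) = of_real k / 4 * E \<zeta>"
  by (simp add: alpha_def d_z_a W_I E_def a_eq algebra_simps diff_divide_distrib)

text \<open>Since \<open>Z\<close> is independent of \<open>u\<close>, \<open>nu\<close> is
  \<open>G\<close> times the conjugate of \<open>d_z f\<close>. The exponential term of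
  \<open>d_z f\<close> gives \<open>1 / (4 * alpha)\<close>; the other term keeps
  \<open>G\<close>.\<close>

lemma nu_eq:
  assumes "(\<zeta>, u, v) \<in> M"
  shows "nu f a Z (\<zeta>, u, v) = 1 / (of_real k * E \<zeta>) + cnj (g u) * G \<zeta>"
proof -
  have "cnj (exp (4 * c)) = (of_real k)\<^sup>2"
    unfolding exp_c by simp
  then have c4: "exp (4 * cnj c) = (of_real k)\<^sup>2" by (simp add: exp_cnj)
  \<comment> \<open>The product \<open>G \<zeta> * E \<zeta>\<close> is
    \<open>exp (- 4 * cnj a)\<close>, and the first two factors make up
    \<open>exp (4 * cnj a)\<close>.\<close>
  have "exp (4 * cnj c) * exp (of_real k * cnj \<zeta>) * G \<zeta> * E \<zeta> = 1"
    unfolding E_def G_def exp_add[symmetric] by (simp add: field_simps)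
  then have "(of_real k)\<^sup>2 * exp (of_real k * cnj \<zeta>) * G \<zeta> * E \<zeta> = 1"
    unfolding c4 .
  then have *: "G \<zeta> * (of_real k * exp (of_real k * cnj \<zeta>)) = 1 / (of_real k * E \<zeta>)"
    using k by (simp add: E_def field_simps power2_eq_square)
  have "exp (- a \<zeta> u - 3 * cnj (a \<zeta> u)) = G \<zeta>"
    unfolding G_def a_eq[OF W_I[OF assms]] by (rule arg_cong[of _ _ exp]) (simp add: field_simps)
  then have "nu f a Z (\<zeta>, u, v) = G \<zeta> * (of_real k * exp (of_real k * cnj \<zeta>) + cnj (g u))"
    using d_u_d_u_Z[OF a_mem[OF assms]] by (simp add: nu_def d_z_f exp_cnj)
  then show ?thesis using * by (simp add: algebra_simps)
qed

lemma E_nz: "E \<zeta> \<noteq> 0" and G_nz: "G \<zeta> \<noteq> 0"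
  by (auto simp: E_def G_def)

lemma has_derivative_E:
  "((\<lambda>p. E (fst p)) has_derivative (\<lambda>h. of_real k / 4 * E \<zeta> * (fst h - cnj (fst h))))
    (at (\<zeta>, x))"
proof -
  have "((\<lambda>p. of_real k * (fst p - cnj (fst p)) / 4 + (c - cnj c)) has_derivative
      (\<lambda>h. of_real k * (fst h - cnj (fst h)) / 4)) (at (\<zeta>, x))"
    by (auto intro!: derivative_eq_intros)
  from has_derivative_compose_field_derivative[OF DERIV_exp this] show ?thesis
    unfolding E_def by (rule has_derivative_eq_rhs) (simp add: mult_ac)
qed

lemma has_derivative_inverse_E:
  "((\<lambda>p. 1 / (of_real k * E (fst p))) has_derivative (\<lambda>h. - ((fst h - cnj (fst h)) / (4 * E \<zeta>))))
    (at (\<zeta>, x))"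
proof -
  have "((\<lambda>w. 1 / (of_real k * w)) has_field_derivative - 1 / (of_real k * (E \<zeta>)\<^sup>2))
      (at (E (fst (\<zeta>, x))))"
    using k E_nz[of \<zeta>] by (auto intro!: derivative_eq_intros simp: power2_eq_square)
  from has_derivative_compose_field_derivative[OF this has_derivative_E] show ?thesis
    by (rule has_derivative_eq_rhs) (use k E_nz[of \<zeta>] in \<open>simp add: power2_eq_square mult.commute\<close>)
qed

lemma has_derivative_G:
  "((\<lambda>p. G (fst p)) has_derivative (\<lambda>h. - of_real k / 4 * G \<zeta> * (fst h + 3 * cnj (fst h))))
    (at (\<zeta>, x))"
proof -
  have "((\<lambda>p. - of_real k * (fst p + 3 * cnj (fst p)) / 4 - (c + 3 * cnj c)) has_derivative
      (\<lambda>h. - of_real k * (fst h + 3 * cnj (fst h)) / 4)) (at (\<zeta>, x))"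
    by (auto intro!: derivative_eq_intros)
  from has_derivative_compose_field_derivative[OF DERIV_exp this] show ?thesis
    unfolding G_def by (rule has_derivative_eq_rhs) (simp add: mult_ac)
qed

lemma ext_d_alpha:
  assumes "(\<zeta>, u, v) \<in> M"
  shows "ext_d (alpha a) (\<zeta>, u, v) =
    (\<lambda>(d\<zeta>, du, dv). (of_real k / 4)\<^sup>2 * E \<zeta> * (d\<zeta> - cnj d\<zeta>))"
proof (rule ext_d_eqI[OF open_M assms])
  show "alpha a q = of_real k / 4 * E (fst q)" if "q \<in> M" for q
    using that by (cases q) (simp add: alpha_eq)
  show "((\<lambda>q. of_real k / 4 * E (fst q)) has_derivative
      (\<lambda>(d\<zeta>, du, dv). (of_real k / 4)\<^sup>2 * E \<zeta> * (d\<zeta> - cnj d\<zeta>))) (at (\<zeta>, u, v))"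
    by (rule has_derivative_eq_rhs[OF has_derivative_mult_right[OF has_derivative_E]])
       (simp add: power2_eq_square case_prod_unfold mult_ac)
qed

section \<open>The invariants \<open>A\<close> and \<open>Y\<close>\<close>

lemma inv_A_eq:
  assumes "(\<zeta>, u, v) \<in> M"
  shows "inv_A f a Z (\<zeta>, u, v) = -1"
proof -
  have Ea: "exp (a \<zeta> u - cnj (a \<zeta> u)) = E \<zeta>"
    using assms by (simp add: E_def a_eq W_I algebra_simps diff_divide_distrib)
  \<comment> \<open>As \<open>k\<close> is real, the exponent of \<open>E\<close> is purely
    imaginary.\<close>
  have cE: "cnj (E \<zeta>) = 1 / E \<zeta>"
  proof -
    have "E \<zeta> * cnj (E \<zeta>) = 1"
      by (simp add: E_def exp_cnj exp_add[symmetric] field_simps)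
    then show ?thesis using E_nz[of \<zeta>] by (simp add: field_simps)
  qed
  \<comment> \<open>With \<open>d_u Z\<close> zero, \<open>omega1\<close> is \<open>E\<close> times
    d\<zeta> and \<open>omega2\<close> is d\<zeta> conjugated over \<open>E\<close>. The
    coefficients come from substituting this in \<open>ext_d_alpha\<close>; the second one is minus
    the square of \<open>alpha\<close>.\<close>
  have "frame_derivs f a Z (alpha a) (\<zeta>, u, v) =
    ((of_real k / 4)\<^sup>2, - ((of_real k / 4)\<^sup>2 * (E \<zeta>)\<^sup>2), 0, 0)"
  proof (rule frame_derivs_eqI)
    fix h
    have "omega1 a Z (\<zeta>, u, v) h = E \<zeta> * fst h"
      using d_u_Z[OF a_mem[OF assms]] by (simp add: omega1_def Ea case_prod_unfold)
    then show "ext_d (alpha a) (\<zeta>, u, v) h =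
      (of_real k / 4)\<^sup>2 * omega1 a Z (\<zeta>, u, v) h +
      - ((of_real k / 4)\<^sup>2 * (E \<zeta>)\<^sup>2) * omega2 a Z (\<zeta>, u, v) h +
      0 * omega3 a (\<zeta>, u, v) h + 0 * omega4 f a Z (\<zeta>, u, v) h"
      using E_nz[of \<zeta>]
      by (simp add: ext_d_alpha[OF assms] omega2_def cE case_prod_unfold
            power2_eq_square[of "E \<zeta>"] algebra_simps)
  qed
  then show ?thesis
    using assms k E_nz[of \<zeta>]
    by (simp add: inv_A_def delta_star_def alpha_eq power_mult_distrib power_divide)
qed

text \<open>With \<open>A\<close> equal to -1 and \<open>mu\<close> zero, \<open>Y\<close> is
  \<open>4 * nu - 1 / alpha\<close>, and the first term of \<open>nu\<close> cancels
  exactly.\<close>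

lemma inv_Y_eq:
  assumes "(\<zeta>, u, v) \<in> M"
  shows "inv_Y f a Z L (\<zeta>, u, v) = 4 * cnj (g u) * G \<zeta>"
  using assms by (simp add: inv_Y_def inv_A_eq Delta_mu mu_eq nu_eq alpha_eq distrib_left)

lemma inv_Y_zero_iff: "(\<forall>p\<in>M. inv_Y f a Z L p = 0) \<longleftrightarrow> (\<forall>(\<zeta>, u, v)\<in>M. g u = 0)"
  by (auto simp: inv_Y_eq G_nz)

section \<open>The condition that the differentials of \<open>alpha\<close> and \<open>nu\<close>
  are proportional\<close>

text \<open>Smoothness is assumed of \<open>f\<close> only, whereas computing \<open>ext_d\<close>
  of \<open>nu\<close> for nonzero \<open>g\<close> calls for a derivative of \<open>g\<close>
  itself.\<close>

lemma g_differentiable: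
  assumes "(\<zeta>, u) \<in> W"
  shows "g differentiable (at u)"
proof -
  have "open ((\<lambda>w. (w, u)) -` W)"
    by (intro open_vimage open_W continuous_intros)
  then obtain e where e: "e > 0" "\<And>w. dist w \<zeta> < e \<Longrightarrow> (w, u) \<in> W"
    using assms by (auto simp: open_dist)
  \<comment> \<open>\<open>g\<close> is only recovered from \<open>f\<close> at a point with nonzero \<open>\<zeta>\<close>.\<close>
  define w where "w = (if \<zeta> = 0 then of_real (e / 2) else \<zeta>)"
  have w: "w \<noteq> 0" "(w, u) \<in> W"
    using e assms by (auto simp: w_def intro!: e(2))
  have "k_smooth_on (Suc 0) W (\<lambda>(\<zeta>, u). f \<zeta> u)"
    using wave unfolding vacuum_pp_wave_def smooth_on_def by blast
  then have "(\<lambda>(\<zeta>, u). f \<zeta> u) differentiable (at (w, u))"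
    using w(2) by simp
  then have "(\<lambda>(\<zeta>, u). f \<zeta> u) \<circ> (\<lambda>t. (w, t)) differentiable (at u)"
    by (intro differentiable_chain_at) auto
  then have "(\<lambda>t. f w t) differentiable (at u)"
    by (simp add: o_def)
  then have "(\<lambda>t. (f w t - exp (of_real k * w)) * (1 / w)) differentiable (at u)"
    by (intro derivative_intros)
  then show ?thesis using w(1) by (simp add: f)
qed

text \<open>Both differentials are multiples of \<open>d\<zeta> - cnj d\<zeta>\<close>. Vanishing of
  \<open>g\<close> on all of \<open>M\<close> gives the closed form of \<open>nu\<close> near the
  point, as its differential requires.\<close>

lemma g_zero_imp_wedge:
  assumes g: "\<forall>(\<zeta>, u, v)\<in>M. g u = 0" and "(\<zeta>, u, v) \<in> M"
  shows "wedge (ext_d (alpha a) (\<zeta>, u, v)) (ext_d (nu f a Z) (\<zeta>, u, v)) = (\<lambda>_ _. 0)"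
proof -
  have "ext_d (nu f a Z) (\<zeta>, u, v) = (\<lambda>(d\<zeta>, du, dv). - ((d\<zeta> - cnj d\<zeta>) / (4 * E \<zeta>)))"
  proof (rule ext_d_eqI[OF open_M assms(2)])
    show "nu f a Z q = 1 / (of_real k * E (fst q))" if "q \<in> M" for q
      using that g by (cases q) (auto simp: nu_eq)
    show "((\<lambda>q. 1 / (of_real k * E (fst q))) has_derivative
        (\<lambda>(d\<zeta>, du, dv). - ((d\<zeta> - cnj d\<zeta>) / (4 * E \<zeta>)))) (at (\<zeta>, u, v))"
      using has_derivative_inverse_E by (simp add: case_prod_unfold)
  qed
  then show ?thesis
    unfolding wedge_def ext_d_alpha[OF assms(2)] case_prod_unfold
    by (simp add: mult_ac)
qed

lemma wedge_imp_g_zero: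
  assumes M: "(\<zeta>, u, v) \<in> M"
    and wedge: "wedge (ext_d (alpha a) (\<zeta>, u, v)) (ext_d (nu f a Z) (\<zeta>, u, v)) = (\<lambda>_ _. 0)"
  shows "g u = 0"
proof -
  obtain g' where g': "(g has_derivative g') (at u)"
    using g_differentiable[OF W_I[OF M]] by (auto simp: differentiable_def)
  then have "g' 0 = 0"
    by (simp add: has_derivative_def bounded_linear.linear linear_0)
  have "((\<lambda>q. fst (snd q)) has_derivative (\<lambda>h. fst (snd h))) (at (\<zeta>, u, v))"
    by (auto intro!: derivative_eq_intros)
  from has_derivative_compose[OF this, of g g'] g'
  have g'_fst: "((\<lambda>q. g (fst (snd q))) has_derivative (\<lambda>h. g' (fst (snd h)))) (at (\<zeta>, u, v))"
    by simp
  have "ext_d (nu f a Z) (\<zeta>, u, v) = (\<lambda>h. - ((fst h - cnj (fst h)) / (4 * E \<zeta>)) +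
      (cnj (g u) * (- of_real k / 4 * G \<zeta> * (fst h + 3 * cnj (fst h))) +
       cnj (g' (fst (snd h))) * G \<zeta>))"
  proof (rule ext_d_eqI[OF open_M M])
    show "nu f a Z q = 1 / (of_real k * E (fst q)) + cnj (g (fst (snd q))) * G (fst q)"
      if "q \<in> M" for q
      using that by (cases q) (simp add: nu_eq)
    show "((\<lambda>q. 1 / (of_real k * E (fst q)) + cnj (g (fst (snd q))) * G (fst q)) has_derivative
       (\<lambda>h. - ((fst h - cnj (fst h)) / (4 * E \<zeta>)) +
      (cnj (g u) * (- of_real k / 4 * G \<zeta> * (fst h + 3 * cnj (fst h))) +
       cnj (g' (fst (snd h))) * G \<zeta>))) (at (\<zeta>, u, v))"
      using has_derivative_add[OF has_derivative_inverse_E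
          has_derivative_mult[OF has_derivative_cnj[OF g'_fst] has_derivative_G]] by simp
  qed
  \<comment> \<open>The direction \<open>(1, 0, 0)\<close> is the real translation of
    \<open>\<zeta>\<close>: it annihilates the differential of \<open>1 / E\<close>, has no
    \<open>u\<close> component, and scales \<open>G\<close> by
    \<open>-k/4 * (1 + 3)\<close>.\<close>
  then have nu_1: "ext_d (nu f a Z) (\<zeta>, u, v) (1, 0, 0) = - (cnj (g u) * G \<zeta> * of_real k)"
    using \<open>g' 0 = 0\<close> by simp
  \<comment> \<open>The differential of \<open>alpha\<close> vanishes on \<open>(1, 0, 0)\<close>
    but not on \<open>(\<i>, 0, 0)\<close>, so this pair isolates the value
    \<open>nu_1\<close>.\<close>
  have "wedge (ext_d (alpha a) (\<zeta>, u, v)) (ext_d (nu f a Z) (\<zeta>, u, v)) (1, 0, 0) (\<i>, 0, 0) = 0"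
    using wedge by simp
  then show ?thesis
    using k E_nz[of \<zeta>] G_nz[of \<zeta>] by (simp add: wedge_def ext_d_alpha[OF M] nu_1)
qed

lemma wedge_zero_iff:
  "(\<forall>p\<in>M. wedge (ext_d (alpha a) p) (ext_d (nu f a Z) p) = (\<lambda>_ _. 0)) \<longleftrightarrow>
   (\<forall>(\<zeta>, u, v)\<in>M. g u = 0)"
proof
  assume *: "\<forall>p\<in>M. wedge (ext_d (alpha a) p) (ext_d (nu f a Z) p) = (\<lambda>_ _. 0)"
  show "\<forall>(\<zeta>, u, v)\<in>M. g u = 0"
  proof clarify
    fix \<zeta> u v assume M: "(\<zeta>, u, v) \<in> M"
    with * show "g u = 0" by (intro wedge_imp_g_zero[OF M]) (rule bspec)
  qed
next
  assume g: "\<forall>(\<zeta>, u, v)\<in>M. g u = 0"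
  show "\<forall>p\<in>M. wedge (ext_d (alpha a) p) (ext_d (nu f a Z) p) = (\<lambda>_ _. 0)"
  proof
    fix p assume "p \<in> M"
    then show "wedge (ext_d (alpha a) p) (ext_d (nu f a Z) p) = (\<lambda>_ _. 0)"
      by (cases p) (simp only: g_zero_imp_wedge[OF g])
  qed
qed

end

theorem proposition8p3:
  fixes M :: "point set" and k :: real and g :: "real \<Rightarrow> complex"
    and f a Z L :: "complex \<Rightarrow> real \<Rightarrow> complex"
  assumes "k \<noteq> 0"
    and f: "f = (\<lambda>\<zeta> u. exp (of_real k * \<zeta>) + g u * \<zeta>)"
    and "vacuum_pp_wave M f"
    and "adapted_functions M f a Z L"
  shows "((\<forall>p\<in>M. wedge (ext_d (alpha a) p) (ext_d (nu f a Z) p) = (\<lambda>_ _. 0)) \<longleftrightarrow>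
          (\<forall>p\<in>M. inv_Y f a Z L p = 0)) \<and>
         ((\<forall>p\<in>M. inv_Y f a Z L p = 0) \<longleftrightarrow> (\<forall>(\<zeta>, u, v)\<in>M. g u = 0))"
proof -
  interpret AE13 M k g f a Z L
    using assms by unfold_locales
  \<comment> \<open>Once both conditions are replaced by the vanishing of \<open>g\<close>, each
    equivalence is reflexive.\<close>
  show ?thesis
    unfolding wedge_zero_iff inv_Y_zero_iff by (intro conjI refl)
qed

end
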